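(* Let $X$ be a metric space and let $\mathrm{Pos}$ be a located predicate in its localic completion $\mathrm{loc}(X)$. Then the positively closed sublocale defined by $\mathrm{Pos}$ coincides with the closed sublocale defined by the open $\neg\mathrm{Pos}=\{u\in S:\neg\mathrm{Pos}(u)\}$.
   Context: Everything is constructive and predicative: intuitionistic logic, no axiom of choice (not even countable choice). A metric space is a set $X$ with a ternary relation $d(x,y)<r$ ($x,y\in X$, $r\in\mathbb{Q}^{>0}$) such that: for all $x,y$ there is $r$ with $d(x,y)<r$; if $d(x,y)<r$ then $d(x,y)<s$ for some $s<r$; $d(x,y)<r$ for all $r>0$ iff $x=y$; $d(x,y)<r$ iff $d(y,x)<r$; $d(x,y)<r$ and $d(y,z)<s$ imply $d(x,z)<r+s$. For rational $q\le 0$, "$d(x,y)<q$" is false. A formal topology is a preorder $(S,\le)$ with a covering relation $\vartriangleleft$ between elements and subsets of $S$ such that: (Ref) $a\in U$ implies $a\vartriangleleft U$; (Tra) $a\vartriangleleft U$ and $U\vartriangleleft V$ imply $a\vartriangleleft V$, where $U\vartriangleleft V$ means $u\vartriangleleft V$ for all $u\in U$; (Loc) $a\vartriangleleft U$ and $a\vartriangleleft V$ imply $a\vartriangleleft\{x:\exists u\in U\,\exists v\in V\;(x\le u,\ x\le v)\}$; (Ext) $a\le b$ implies $a\vartriangleleft\{b\}$. A sublocale is given by a covering relation on $(S,\le)$ containing $\vartriangleleft$; sublocales coincide if their covering relations are equal. For $U\subseteq S$, the closed sublocale defined by the open $U$ (its complement) has covering $u\vartriangleleft' V$ iff $u\vartriangleleft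 V\cup U$. A subset $F\subseteq S$ is positively closed if $F(u)$ and $u\vartriangleleft V$ imply $F(v)$ for some $v\in V$; the positively closed sublocale defined by $F$ is given by the least covering relation $\vartriangleleft_F$ containing $\vartriangleleft$ with $u\vartriangleleft_F\{u' : u'=u\text{ and }F(u)\}$ for all $u$. The localic completion $\mathrm{loc}(X)$ is the formal topology with $S=\{B_r(x):x\in X,\ r\in\mathbb{Q}^{>0}\}$ (formal balls, i.e. pairs $(x,r)$), $B_r(x)<B_s(y)$ iff $d(x,y)<s-r$, $B_r(x)\le B_s(y)$ iff $d(x,y)<t$ for all rational $t>s-r$, and $\vartriangleleft$ the covering relation inductively generated by (M1) $u\vartriangleleft\{v:v<u\}$ and (M2) $S\vartriangleleft\{B_r(x):x\in X\}$ for every $r$. A positively closed predicate $\mathrm{Pos}$ on $S$ is located if $v<u$ implies $\neg\mathrm{Pos}(v)$ or $\mathrm{Pos}(u)$. *)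

theory Defs
  imports Complex_Main
begin

text \<open>
  Isabelle/HOL is classical, and classically every positively closed predicate is located, while
  closed and positively closed sublocales agree in any formal topology. To keep the intuitionistic
  content, the mathematics below is written in a shallow embedding of intuitionistic higher-order
  logic: a proposition is an element of an arbitrary frame (complete Heyting algebra) \<open>'h\<close>, the
  bold connectives and quantifiers are the usual Heyting-valued ones, and \<open>\<Turnstile> \<phi>\<close> says that \<open>\<phi>\<close>
  holds. Excluded middle and the axiom of choice are in general not valid in this reading. For
  \<open>'h = bool\<close> all connectives are the ordinary ones (\<open>bool_connectives\<close> below), so that the
  definitions specialise to their classical versions.
\<close>

class frame = complete_lattice +
  assumes inf_Sup_distrib: "inf a (Sup B) = (SUP b\<in>B. inf a b)"

subclass (in complete_distrib_lattice) frame
  by unfold_locales (rule inf_Sup)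

instance bool :: frame ..

definition valid :: "'h::frame \<Rightarrow> bool"  ("\<Turnstile> _" [5] 5)
  where "(\<Turnstile> p) \<longleftrightarrow> p = top"

definition h_and :: "'h::frame \<Rightarrow> 'h \<Rightarrow> 'h"  (infixr "\<^bold>\<and>" 35)
  where "(p \<^bold>\<and> q) = inf p q"

definition h_or :: "'h::frame \<Rightarrow> 'h \<Rightarrow> 'h"  (infixr "\<^bold>\<or>" 30)
  where "(p \<^bold>\<or> q) = sup p q"

definition h_imp :: "'h::frame \<Rightarrow> 'h \<Rightarrow> 'h"  (infixr "\<^bold>\<longrightarrow>" 25)
  where "(p \<^bold>\<longrightarrow> q) = Sup {r. inf r p \<le> q}"

definition h_iff :: "'h::frame \<Rightarrow> 'h \<Rightarrow> 'h"  (infixr "\<^bold>\<longleftrightarrow>" 25)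
  where "(p \<^bold>\<longleftrightarrow> q) = ((p \<^bold>\<longrightarrow> q) \<^bold>\<and> (q \<^bold>\<longrightarrow> p))"

definition h_not :: "'h::frame \<Rightarrow> 'h"  ("\<^bold>\<not> _" [40] 40)
  where "(\<^bold>\<not> p) = (p \<^bold>\<longrightarrow> bot)"

definition h_all :: "('a \<Rightarrow> 'h::frame) \<Rightarrow> 'h"  (binder "\<^bold>\<forall>" 10)
  where "(\<^bold>\<forall>x. \<phi> x) = (INF x. \<phi> x)"

definition h_ex :: "('a \<Rightarrow> 'h::frame) \<Rightarrow> 'h"  (binder "\<^bold>\<exists>" 10)
  where "(\<^bold>\<exists>x. \<phi> x) = (SUP x. \<phi> x)"

text \<open>Equality and order of the rationals are decidable, so statements about them are two-valued.\<close>

definition decidable :: "bool \<Rightarrow> 'h::frame"  ("\<^bold>[_\<^bold>]")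
  where "\<^bold>[P\<^bold>] = (if P then top else bot)"

lemma le_h_imp_iff: "r \<le> (p \<^bold>\<longrightarrow> q) \<longleftrightarrow> inf r p \<le> q" for p q r :: "'h::frame"
proof
  assume "r \<le> (p \<^bold>\<longrightarrow> q)"
  then have "inf r p \<le> inf p (Sup {r. inf r p \<le> q})"
    unfolding h_imp_def by (simp add: le_infI1)
  also have "\<dots> \<le> q"
    unfolding inf_Sup_distrib by (auto intro!: SUP_least simp: inf_commute)
  finally show "inf r p \<le> q" .
next
  assume "inf r p \<le> q"
  then show "r \<le> (p \<^bold>\<longrightarrow> q)" unfolding h_imp_def by (intro Sup_upper) simp
qed

lemma bool_connectives:
  fixes p q :: bool and \<phi> :: "'a \<Rightarrow> bool"
  shows "(\<Turnstile> p) \<longleftrightarrow> p" "(p \<^bold>\<and> q) \<longleftrightarrow> p \<and> q" "(p \<^bold>\<or> q) \<longleftrightarrow> p \<or> q" "(p \<^bold>\<longrightarrow> q) \<longleftrightarrow> (p \<longrightarrow> q)"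
    "(p \<^bold>\<longleftrightarrow> q) \<longleftrightarrow> (p \<longleftrightarrow> q)" "(\<^bold>\<not> p) \<longleftrightarrow> \<not> p" "(\<^bold>\<forall>x. \<phi> x) \<longleftrightarrow> (\<forall>x. \<phi> x)" "(\<^bold>\<exists>x. \<phi> x) \<longleftrightarrow> (\<exists>x. \<phi> x)"
    "\<^bold>[p\<^bold>] \<longleftrightarrow> p"
  unfolding valid_def h_and_def h_or_def h_iff_def h_imp_def h_not_def h_all_def h_ex_def decidable_def
  by auto

text \<open>
  A set is given by a membership predicate \<open>A\<close> and an equality \<open>eq\<close>, both valued in \<open>'h\<close> (so it may
  have partially defined elements and undecidable equality); only elements satisfying \<open>A\<close> matter. A
  subset is an \<open>'h\<close>-valued predicate \<open>U\<close> contained in \<open>A\<close> and respecting equality.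
\<close>

definition is_set :: "('b \<Rightarrow> 'h::frame) \<Rightarrow> ('b \<Rightarrow> 'b \<Rightarrow> 'h) \<Rightarrow> 'h" where
  "is_set A eq =
    ((\<^bold>\<forall>a. A a \<^bold>\<longrightarrow> eq a a) \<^bold>\<and>
     (\<^bold>\<forall>a b. A a \<^bold>\<and> A b \<^bold>\<and> eq a b \<^bold>\<longrightarrow> eq b a) \<^bold>\<and>
     (\<^bold>\<forall>a b c. A a \<^bold>\<and> A b \<^bold>\<and> A c \<^bold>\<and> eq a b \<^bold>\<and> eq b c \<^bold>\<longrightarrow> eq a c))"

definition is_subset :: "('b \<Rightarrow> 'h::frame) \<Rightarrow> ('b \<Rightarrow> 'b \<Rightarrow> 'h) \<Rightarrow> ('b \<Rightarrow> 'h) \<Rightarrow> 'h" where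
  "is_subset A eq U =
    ((\<^bold>\<forall>a. U a \<^bold>\<longrightarrow> A a) \<^bold>\<and> (\<^bold>\<forall>a b. U a \<^bold>\<and> A b \<^bold>\<and> eq a b \<^bold>\<longrightarrow> U b))"

text \<open>
  A covering relation on a preorder \<open>(S, le)\<close>: the first clause says that it relates elements to
  subsets of \<open>S\<close>, the others are (Ref), (Tra), (Loc) and (Ext).
\<close>

definition covering ::
  "('b \<Rightarrow> 'h::frame) \<Rightarrow> ('b \<Rightarrow> 'b \<Rightarrow> 'h) \<Rightarrow> ('b \<Rightarrow> 'b \<Rightarrow> 'h) \<Rightarrow> ('b \<Rightarrow> ('b \<Rightarrow> 'h) \<Rightarrow> 'h) \<Rightarrow> 'h" where
  "covering S eq le cov =
    ((\<^bold>\<forall>a U. cov a U \<^bold>\<longrightarrow> S a \<^bold>\<and> is_subset S eq U) \<^bold>\<and>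
     (\<^bold>\<forall>a U. is_subset S eq U \<^bold>\<and> U a \<^bold>\<longrightarrow> cov a U) \<^bold>\<and>
     (\<^bold>\<forall>a U V. is_subset S eq V \<^bold>\<and> cov a U \<^bold>\<and> (\<^bold>\<forall>u. U u \<^bold>\<longrightarrow> cov u V) \<^bold>\<longrightarrow> cov a V) \<^bold>\<and>
     (\<^bold>\<forall>a U V. cov a U \<^bold>\<and> cov a V \<^bold>\<longrightarrow>
        cov a (\<lambda>x. S x \<^bold>\<and> (\<^bold>\<exists>u v. U u \<^bold>\<and> V v \<^bold>\<and> le x u \<^bold>\<and> le x v))) \<^bold>\<and>
     (\<^bold>\<forall>a b. S a \<^bold>\<and> S b \<^bold>\<and> le a b \<^bold>\<longrightarrow> cov a (\<lambda>x. S x \<^bold>\<and> eq x b)))"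

definition contains_cover ::
  "('b \<Rightarrow> ('b \<Rightarrow> 'h::frame) \<Rightarrow> 'h) \<Rightarrow> ('b \<Rightarrow> ('b \<Rightarrow> 'h) \<Rightarrow> 'h) \<Rightarrow> 'h" where
  "contains_cover cov' cov = (\<^bold>\<forall>a U. cov a U \<^bold>\<longrightarrow> cov' a U)"

definition is_sublocale ::
  "('b \<Rightarrow> 'h::frame) \<Rightarrow> ('b \<Rightarrow> 'b \<Rightarrow> 'h) \<Rightarrow> ('b \<Rightarrow> 'b \<Rightarrow> 'h) \<Rightarrow> ('b \<Rightarrow> ('b \<Rightarrow> 'h) \<Rightarrow> 'h) \<Rightarrow>
    ('b \<Rightarrow> ('b \<Rightarrow> 'h) \<Rightarrow> 'h) \<Rightarrow> 'h" where
  "is_sublocale S eq le cov cov' = (covering S eq le cov' \<^bold>\<and> contains_cover cov' cov)"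

definition coincide ::
  "('b \<Rightarrow> ('b \<Rightarrow> 'h::frame) \<Rightarrow> 'h) \<Rightarrow> ('b \<Rightarrow> ('b \<Rightarrow> 'h) \<Rightarrow> 'h) \<Rightarrow> 'h" where
  "coincide cov cov' = (\<^bold>\<forall>a U. cov a U \<^bold>\<longleftrightarrow> cov' a U)"

definition closed_cover ::
  "('b \<Rightarrow> 'h::frame) \<Rightarrow> ('b \<Rightarrow> 'b \<Rightarrow> 'h) \<Rightarrow> ('b \<Rightarrow> ('b \<Rightarrow> 'h) \<Rightarrow> 'h) \<Rightarrow> ('b \<Rightarrow> 'h) \<Rightarrow>
    'b \<Rightarrow> ('b \<Rightarrow> 'h) \<Rightarrow> 'h" where
  "closed_cover S eq cov U a V = (is_subset S eq V \<^bold>\<and> cov a (\<lambda>v. V v \<^bold>\<or> U v))"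

definition positively_closed ::
  "('b \<Rightarrow> 'h::frame) \<Rightarrow> ('b \<Rightarrow> 'b \<Rightarrow> 'h) \<Rightarrow> ('b \<Rightarrow> ('b \<Rightarrow> 'h) \<Rightarrow> 'h) \<Rightarrow> ('b \<Rightarrow> 'h) \<Rightarrow> 'h" where
  "positively_closed S eq cov F =
    (is_subset S eq F \<^bold>\<and> (\<^bold>\<forall>u V. F u \<^bold>\<and> cov u V \<^bold>\<longrightarrow> (\<^bold>\<exists>v. V v \<^bold>\<and> F v)))"

text \<open>Least covering relations are intersections of all covering relations with the given property.\<close>

definition positively_closed_cover ::
  "('b \<Rightarrow> 'h::frame) \<Rightarrow> ('b \<Rightarrow> 'b \<Rightarrow> 'h) \<Rightarrow> ('b \<Rightarrow> 'b \<Rightarrow> 'h) \<Rightarrow> ('b \<Rightarrow> ('b \<Rightarrow> 'h) \<Rightarrow> 'h) \<Rightarrow>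
    ('b \<Rightarrow> 'h) \<Rightarrow> 'b \<Rightarrow> ('b \<Rightarrow> 'h) \<Rightarrow> 'h" where
  "positively_closed_cover S eq le cov F a U =
    (\<^bold>\<forall>C. is_sublocale S eq le cov C \<^bold>\<and>
       (\<^bold>\<forall>u. S u \<^bold>\<longrightarrow> C u (\<lambda>u'. S u' \<^bold>\<and> eq u' u \<^bold>\<and> F u)) \<^bold>\<longrightarrow> C a U)"

text \<open>
  \<open>d x y r\<close> stands for \<open>d(x,y) < r\<close>; it is false for \<open>r \<le> 0\<close>. That \<open>d\<close>, and with it the orders on
  formal balls, respects the equality of points follows from the axioms.
\<close>

definition metric_space ::
  "('a \<Rightarrow> 'h::frame) \<Rightarrow> ('a \<Rightarrow> 'a \<Rightarrow> 'h) \<Rightarrow> ('a \<Rightarrow> 'a \<Rightarrow> rat \<Rightarrow> 'h) \<Rightarrow> 'h" where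
  "metric_space X eq d =
    (is_set X eq \<^bold>\<and>
     (\<^bold>\<forall>x y r. X x \<^bold>\<and> X y \<^bold>\<and> d x y r \<^bold>\<longrightarrow> \<^bold>[0 < r\<^bold>]) \<^bold>\<and>
     (\<^bold>\<forall>x y. X x \<^bold>\<and> X y \<^bold>\<longrightarrow> (\<^bold>\<exists>r. d x y r)) \<^bold>\<and>
     (\<^bold>\<forall>x y r. X x \<^bold>\<and> X y \<^bold>\<and> d x y r \<^bold>\<longrightarrow> (\<^bold>\<exists>s. \<^bold>[s < r\<^bold>] \<^bold>\<and> d x y s)) \<^bold>\<and>
     (\<^bold>\<forall>x y. X x \<^bold>\<and> X y \<^bold>\<longrightarrow> ((\<^bold>\<forall>r. \<^bold>[0 < r\<^bold>] \<^bold>\<longrightarrow> d x y r) \<^bold>\<longleftrightarrow> eq x y)) \<^bold>\<and>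
     (\<^bold>\<forall>x y r. X x \<^bold>\<and> X y \<^bold>\<longrightarrow> (d x y r \<^bold>\<longleftrightarrow> d y x r)) \<^bold>\<and>
     (\<^bold>\<forall>x y z r s. X x \<^bold>\<and> X y \<^bold>\<and> X z \<^bold>\<and> d x y r \<^bold>\<and> d y z s \<^bold>\<longrightarrow> d x z (r + s)))"

text \<open>The formal ball \<open>B\<^sub>r(x)\<close> is the pair \<open>(x, r)\<close>.\<close>

fun ball :: "('a \<Rightarrow> 'h::frame) \<Rightarrow> 'a \<times> rat \<Rightarrow> 'h" where
  "ball X (x, r) = (X x \<^bold>\<and> \<^bold>[0 < r\<^bold>])"

fun ball_eq :: "('a \<Rightarrow> 'a \<Rightarrow> 'h::frame) \<Rightarrow> 'a \<times> rat \<Rightarrow> 'a \<times> rat \<Rightarrow> 'h" where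
  "ball_eq eq (x, r) (y, s) = (eq x y \<^bold>\<and> \<^bold>[r = s\<^bold>])"

fun ball_less :: "('a \<Rightarrow> 'a \<Rightarrow> rat \<Rightarrow> 'h::frame) \<Rightarrow> 'a \<times> rat \<Rightarrow> 'a \<times> rat \<Rightarrow> 'h" where
  "ball_less d (x, r) (y, s) = d x y (s - r)"

fun ball_le :: "('a \<Rightarrow> 'a \<Rightarrow> rat \<Rightarrow> 'h::frame) \<Rightarrow> 'a \<times> rat \<Rightarrow> 'a \<times> rat \<Rightarrow> 'h" where
  "ball_le d (x, r) (y, s) = (\<^bold>\<forall>t. \<^bold>[s - r < t\<^bold>] \<^bold>\<longrightarrow> d x y t)"

text \<open>The least covering relation satisfying (M1) and (M2).\<close>

definition loc_cover ::
  "('a \<Rightarrow> 'h::frame) \<Rightarrow> ('a \<Rightarrow> 'a \<Rightarrow> 'h) \<Rightarrow> ('a \<Rightarrow> 'a \<Rightarrow> rat \<Rightarrow> 'h) \<Rightarrow>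
    'a \<times> rat \<Rightarrow> ('a \<times> rat \<Rightarrow> 'h) \<Rightarrow> 'h" where
  "loc_cover X eq d a U =
    (\<^bold>\<forall>C. covering (ball X) (ball_eq eq) (ball_le d) C \<^bold>\<and>
       (\<^bold>\<forall>u. ball X u \<^bold>\<longrightarrow> C u (\<lambda>v. ball X v \<^bold>\<and> ball_less d v u)) \<^bold>\<and>
       (\<^bold>\<forall>r. \<^bold>[0 < r\<^bold>] \<^bold>\<longrightarrow> (\<^bold>\<forall>u. ball X u \<^bold>\<longrightarrow> C u (\<lambda>v. ball X v \<^bold>\<and> \<^bold>[snd v = r\<^bold>])))
       \<^bold>\<longrightarrow> C a U)"

definition located_predicate ::
  "('a \<Rightarrow> 'h::frame) \<Rightarrow> ('a \<Rightarrow> 'a \<Rightarrow> 'h) \<Rightarrow> ('a \<Rightarrow> 'a \<Rightarrow> rat \<Rightarrow> 'h) \<Rightarrow> ('a \<times> rat \<Rightarrow> 'h) \<Rightarrow> 'h" where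
  "located_predicate X eq d Pos =
    (positively_closed (ball X) (ball_eq eq) (loc_cover X eq d) Pos \<^bold>\<and>
     (\<^bold>\<forall>u v. ball X u \<^bold>\<and> ball X v \<^bold>\<and> ball_less d v u \<^bold>\<longrightarrow> \<^bold>\<not> Pos v \<^bold>\<or> Pos u))"

end

theory Submission
  imports Defs
begin

text \<open>
  The inclusion of the closed sublocale's covering in the positively closed one holds in every
  formal topology: in a covering with \<open>u \<lhd> {u' : u' = u and Pos u}\<close>, every \<open>u\<close> with \<open>\<not> Pos u\<close> is
  covered by the empty set, so \<open>\<not> Pos\<close> can be dropped from any cover
  (\<open>closed_cover_imp_positively_closed_cover\<close>).

  For the converse, the closed sublocale is a covering that contains the given one
  (\<open>closed_cover_covering\<close>, \<open>closed_cover_contains\<close>), so by minimality it has only to cover each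
  ball \<open>u\<close> by \<open>{u' : u' = u and Pos u}\<close>. This is where locatedness enters
  (\<open>located_closed_cover\<close>). By (M1) the ball \<open>u\<close> is covered by the balls \<open>v < u\<close>. For each of them
  either \<open>\<not> Pos v\<close>, and then \<open>v\<close> lies in the open that has been removed, or \<open>Pos u\<close>, and then
  \<open>u\<close> itself belongs to \<open>{u' : u' = u and Pos u}\<close> and \<open>v \<le> u\<close>.

  That \<open>loc X\<close> is a covering at all also needs an argument, since it is an intersection of
  coverings: (Ref), (Tra), (Loc) and (Ext) pass to intersections, but that only elements are covered,
  and only by subsets, requires some covering with (M1) and (M2) to exist. The covering of every
  element by every subset is one (\<open>trivial_covering\<close>, \<open>loc_cover_covering\<close>).

  To argue with Heyting-valued propositions as with ordinary ones, truth is relativised to a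
  stage \<open>p\<close> of the frame, in the manner of Kripke-Joyal semantics: \<open>p \<tturnstile> \<phi>\<close> is \<open>p \<le> \<phi>\<close>.
  Implications and negations then quantify over all smaller stages, whereas the true disjunct or
  the witness of an existential statement may have to be chosen on each part of a cover of \<open>p\<close>.
\<close>

section \<open>Kripke-Joyal forcing over a frame\<close>

abbreviation forces :: "'h::frame \<Rightarrow> 'h \<Rightarrow> bool"  (infix "\<tturnstile>" 50)
  where "p \<tturnstile> \<phi> \<equiv> p \<le> \<phi>"

lemma forces_and: "p \<tturnstile> (\<phi> \<^bold>\<and> \<psi>) \<longleftrightarrow> p \<tturnstile> \<phi> \<and> p \<tturnstile> \<psi>"
  by (simp add: h_and_def)

lemma forces_imp: "p \<tturnstile> (\<phi> \<^bold>\<longrightarrow> \<psi>) \<longleftrightarrow> (\<forall>q\<le>p. q \<tturnstile> \<phi> \<longrightarrow> q \<tturnstile> \<psi>)"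
  unfolding le_h_imp_iff by (metis inf.bounded_iff inf.cobounded1 inf.cobounded2 order.refl order.trans)

lemma forces_iff:
  "p \<tturnstile> (\<phi> \<^bold>\<longleftrightarrow> \<psi>) \<longleftrightarrow> (\<forall>q\<le>p. q \<tturnstile> \<phi> \<longrightarrow> q \<tturnstile> \<psi>) \<and> (\<forall>q\<le>p. q \<tturnstile> \<psi> \<longrightarrow> q \<tturnstile> \<phi>)"
  by (simp only: h_iff_def forces_and forces_imp)

lemma forces_not: "p \<tturnstile> (\<^bold>\<not> \<phi>) \<longleftrightarrow> (\<forall>q\<le>p. q \<tturnstile> \<phi> \<longrightarrow> q \<tturnstile> bot)"
  by (simp only: h_not_def forces_imp)

lemma forces_notE:
  assumes "p \<tturnstile> (\<^bold>\<not> \<phi>)" "q \<le> p" "q \<tturnstile> \<phi>"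
  shows "q \<tturnstile> \<psi>"
proof -
  have "q \<tturnstile> bot" using assms unfolding forces_not by blast
  then show ?thesis by (simp add: bot_unique)
qed

lemma forces_all: "p \<tturnstile> (\<^bold>\<forall>x. \<phi> x) \<longleftrightarrow> (\<forall>x. p \<tturnstile> \<phi> x)"
  by (simp add: h_all_def le_INF_iff)

lemmas forces_simps = forces_and forces_imp forces_iff forces_all

lemma forces_exI: "p \<tturnstile> \<phi> x \<Longrightarrow> p \<tturnstile> (\<^bold>\<exists>x. \<phi> x)"
  unfolding h_ex_def by (rule SUP_upper2) auto

text \<open>
  Witnesses exist only locally: by distributivity \<open>p\<close> is the join of the stages at which some
  particular \<open>x\<close> is a witness, and it suffices to reach the conclusion at each of these.
\<close>

lemma forces_exE:
  assumes "p \<tturnstile> (\<^bold>\<exists>x. \<phi> x)" and "\<And>q x. q \<le> p \<Longrightarrow> q \<tturnstile> \<phi> x \<Longrightarrow> q \<tturnstile> \<psi>"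
  shows "p \<tturnstile> \<psi>"
proof -
  have "p = inf p (Sup (range \<phi>))" using assms(1) by (simp add: h_ex_def inf.absorb1)
  also have "\<dots> \<le> \<psi>" unfolding inf_Sup_distrib
    by (auto intro!: SUP_least assms(2)[OF inf.cobounded1 inf.cobounded2])
  finally show ?thesis .
qed

lemma forces_orI1: "p \<tturnstile> \<phi> \<Longrightarrow> p \<tturnstile> (\<phi> \<^bold>\<or> \<psi>)"
  and forces_orI2: "p \<tturnstile> \<psi> \<Longrightarrow> p \<tturnstile> (\<phi> \<^bold>\<or> \<psi>)"
  by (simp_all add: h_or_def le_supI1 le_supI2)

lemma forces_orE:
  assumes "p \<tturnstile> (\<phi> \<^bold>\<or> \<psi>)"
    and "\<And>q. q \<le> p \<Longrightarrow> q \<tturnstile> \<phi> \<Longrightarrow> q \<tturnstile> \<chi>" and "\<And>q. q \<le> p \<Longrightarrow> q \<tturnstile> \<psi> \<Longrightarrow> q \<tturnstile> \<chi>"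
  shows "p \<tturnstile> \<chi>"
proof -
  have "p \<tturnstile> (\<^bold>\<exists>b. if b then \<phi> else \<psi>)"
    using assms(1) by (simp add: h_ex_def h_or_def UNIV_bool sup_commute)
  then show ?thesis by (rule forces_exE) (auto split: if_splits intro: assms(2,3))
qed

lemma forces_decidableI: "P \<Longrightarrow> p \<tturnstile> \<^bold>[P\<^bold>]"
  by (simp add: decidable_def)

lemma forces_decidableE: "p \<tturnstile> \<^bold>[P\<^bold>] \<Longrightarrow> (P \<Longrightarrow> p \<tturnstile> \<psi>) \<Longrightarrow> p \<tturnstile> \<psi>"
  by (cases P) (auto simp: decidable_def bot_unique)

lemma valid_forces: "(\<Turnstile> \<phi>) \<longleftrightarrow> (\<forall>p. p \<tturnstile> \<phi>)"
  by (auto simp: valid_def intro: top.extremum_uniqueI)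

section \<open>Coverings and closed sublocales at a stage\<close>

lemma
  assumes "p \<tturnstile> is_set S eq"
  shows is_set_refl: "q \<le> p \<Longrightarrow> q \<tturnstile> S a \<Longrightarrow> q \<tturnstile> eq a a"
    and is_set_sym: "q \<le> p \<Longrightarrow> q \<tturnstile> S a \<Longrightarrow> q \<tturnstile> S b \<Longrightarrow> q \<tturnstile> eq a b \<Longrightarrow> q \<tturnstile> eq b a"
    and is_set_trans: "q \<le> p \<Longrightarrow> q \<tturnstile> S a \<Longrightarrow> q \<tturnstile> S b \<Longrightarrow> q \<tturnstile> S c \<Longrightarrow>
      q \<tturnstile> eq a b \<Longrightarrow> q \<tturnstile> eq b c \<Longrightarrow> q \<tturnstile> eq a c"
proof -
  note set = assms[unfolded is_set_def forces_simps imp_conjL]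
  show "q \<le> p \<Longrightarrow> q \<tturnstile> S a \<Longrightarrow> q \<tturnstile> eq a a"
    by (rule set[THEN conjunct1, rule_format])
  show "q \<le> p \<Longrightarrow> q \<tturnstile> S a \<Longrightarrow> q \<tturnstile> S b \<Longrightarrow> q \<tturnstile> eq a b \<Longrightarrow> q \<tturnstile> eq b a"
    by (rule set[THEN conjunct2, THEN conjunct1, rule_format])
  show "q \<le> p \<Longrightarrow> q \<tturnstile> S a \<Longrightarrow> q \<tturnstile> S b \<Longrightarrow> q \<tturnstile> S c \<Longrightarrow>
      q \<tturnstile> eq a b \<Longrightarrow> q \<tturnstile> eq b c \<Longrightarrow> q \<tturnstile> eq a c"
    by (rule set[THEN conjunct2, THEN conjunct2, rule_format])
qed

lemma forces_is_subset:
  "p \<tturnstile> is_subset S eq U \<longleftrightarrow>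
    (\<forall>a. \<forall>q\<le>p. q \<tturnstile> U a \<longrightarrow> q \<tturnstile> S a) \<and>
    (\<forall>a b. \<forall>q\<le>p. q \<tturnstile> U a \<and> q \<tturnstile> S b \<and> q \<tturnstile> eq a b \<longrightarrow> q \<tturnstile> U b)"
  by (simp only: is_subset_def forces_simps)

lemma is_subset_or:
  assumes "p \<tturnstile> is_subset S eq U" and "p \<tturnstile> is_subset S eq V"
  shows "p \<tturnstile> is_subset S eq (\<lambda>x. U x \<^bold>\<or> V x)"
  unfolding forces_is_subset
proof (intro conjI allI impI; (elim conjE)?)
  fix a q assume "q \<le> p" "q \<tturnstile> (U a \<^bold>\<or> V a)"
  from this(2) show "q \<tturnstile> S a"
    by (rule forces_orE) (use assms \<open>q \<le> p\<close> in \<open>unfold forces_is_subset, meson order_trans\<close>)+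
next
  fix a b q assume q: "q \<le> p" "q \<tturnstile> S b" "q \<tturnstile> eq a b" and "q \<tturnstile> (U a \<^bold>\<or> V a)"
  from this(4) show "q \<tturnstile> (U b \<^bold>\<or> V b)"
  proof (rule forces_orE)
    fix r assume "r \<le> q" "r \<tturnstile> U a"
    with assms(1) q have "r \<tturnstile> U b" unfolding forces_is_subset by (meson order_trans)
    then show "r \<tturnstile> (U b \<^bold>\<or> V b)" by (rule forces_orI1)
  next
    fix r assume "r \<le> q" "r \<tturnstile> V a"
    with assms(2) q have "r \<tturnstile> V b" unfolding forces_is_subset by (meson order_trans)
    then show "r \<tturnstile> (U b \<^bold>\<or> V b)" by (rule forces_orI2)
  qed
qed

lemma
  assumes "p \<tturnstile> covering S eq le cov"
  shows covering_elem: "q \<le> p \<Longrightarrow> q \<tturnstile> cov a U \<Longrightarrow> q \<tturnstile> S a"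
    and covering_subset: "q \<le> p \<Longrightarrow> q \<tturnstile> cov a U \<Longrightarrow> q \<tturnstile> is_subset S eq U"
    and covering_Ref: "q \<le> p \<Longrightarrow> q \<tturnstile> is_subset S eq U \<Longrightarrow> q \<tturnstile> U a \<Longrightarrow> q \<tturnstile> cov a U"
    and covering_Tra: "q \<le> p \<Longrightarrow> q \<tturnstile> is_subset S eq V \<Longrightarrow> q \<tturnstile> cov a U \<Longrightarrow>
      (\<And>u r. r \<le> q \<Longrightarrow> r \<tturnstile> U u \<Longrightarrow> r \<tturnstile> cov u V) \<Longrightarrow> q \<tturnstile> cov a V"
    and covering_Loc: "q \<le> p \<Longrightarrow> q \<tturnstile> cov a U \<Longrightarrow> q \<tturnstile> cov a V \<Longrightarrow>
      q \<tturnstile> cov a (\<lambda>x. S x \<^bold>\<and> (\<^bold>\<exists>u v. U u \<^bold>\<and> V v \<^bold>\<and> le x u \<^bold>\<and> le x v))"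
    and covering_Ext: "q \<le> p \<Longrightarrow> q \<tturnstile> S a \<Longrightarrow> q \<tturnstile> S b \<Longrightarrow> q \<tturnstile> le a b \<Longrightarrow>
      q \<tturnstile> cov a (\<lambda>x. S x \<^bold>\<and> eq x b)"
proof -
  note cov = assms[unfolded covering_def forces_simps imp_conjL]
  note elem_subset = cov[THEN conjunct1, rule_format]
    and Ref_to_Ext = cov[THEN conjunct2]
  note Tra_to_Ext = Ref_to_Ext[THEN conjunct2] and Loc_Ext = Ref_to_Ext[THEN conjunct2, THEN conjunct2]
  show "q \<le> p \<Longrightarrow> q \<tturnstile> cov a U \<Longrightarrow> q \<tturnstile> S a" by (rule elem_subset[THEN conjunct1])
  show "q \<le> p \<Longrightarrow> q \<tturnstile> cov a U \<Longrightarrow> q \<tturnstile> is_subset S eq U" by (rule elem_subset[THEN conjunct2])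
  show "q \<le> p \<Longrightarrow> q \<tturnstile> is_subset S eq U \<Longrightarrow> q \<tturnstile> U a \<Longrightarrow> q \<tturnstile> cov a U"
    by (rule Ref_to_Ext[THEN conjunct1, rule_format])
  show "q \<le> p \<Longrightarrow> q \<tturnstile> is_subset S eq V \<Longrightarrow> q \<tturnstile> cov a U \<Longrightarrow>
      (\<And>u r. r \<le> q \<Longrightarrow> r \<tturnstile> U u \<Longrightarrow> r \<tturnstile> cov u V) \<Longrightarrow> q \<tturnstile> cov a V"
    by (rule Tra_to_Ext[THEN conjunct1, rule_format])
  show "q \<le> p \<Longrightarrow> q \<tturnstile> cov a U \<Longrightarrow> q \<tturnstile> cov a V \<Longrightarrow>
      q \<tturnstile> cov a (\<lambda>x. S x \<^bold>\<and> (\<^bold>\<exists>u v. U u \<^bold>\<and> V v \<^bold>\<and> le x u \<^bold>\<and> le x v))"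
    by (rule Loc_Ext[THEN conjunct1, rule_format])
  show "q \<le> p \<Longrightarrow> q \<tturnstile> S a \<Longrightarrow> q \<tturnstile> S b \<Longrightarrow> q \<tturnstile> le a b \<Longrightarrow>
      q \<tturnstile> cov a (\<lambda>x. S x \<^bold>\<and> eq x b)"
    by (rule Loc_Ext[THEN conjunct2, rule_format])
qed

lemma coveringI:
  assumes "\<And>q a U. q \<le> p \<Longrightarrow> q \<tturnstile> cov a U \<Longrightarrow> q \<tturnstile> S a"
    and "\<And>q a U. q \<le> p \<Longrightarrow> q \<tturnstile> cov a U \<Longrightarrow> q \<tturnstile> is_subset S eq U"
    and "\<And>q a U. q \<le> p \<Longrightarrow> q \<tturnstile> is_subset S eq U \<Longrightarrow> q \<tturnstile> U a \<Longrightarrow> q \<tturnstile> cov a U"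
    and "\<And>q a U V. q \<le> p \<Longrightarrow> q \<tturnstile> is_subset S eq V \<Longrightarrow> q \<tturnstile> cov a U \<Longrightarrow>
      (\<And>u r. r \<le> q \<Longrightarrow> r \<tturnstile> U u \<Longrightarrow> r \<tturnstile> cov u V) \<Longrightarrow> q \<tturnstile> cov a V"
    and "\<And>q a U V. q \<le> p \<Longrightarrow> q \<tturnstile> cov a U \<Longrightarrow> q \<tturnstile> cov a V \<Longrightarrow>
      q \<tturnstile> cov a (\<lambda>x. S x \<^bold>\<and> (\<^bold>\<exists>u v. U u \<^bold>\<and> V v \<^bold>\<and> le x u \<^bold>\<and> le x v))"
    and "\<And>q a b. q \<le> p \<Longrightarrow> q \<tturnstile> S a \<Longrightarrow> q \<tturnstile> S b \<Longrightarrow> q \<tturnstile> le a b \<Longrightarrow>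
      q \<tturnstile> cov a (\<lambda>x. S x \<^bold>\<and> eq x b)"
  shows "p \<tturnstile> covering S eq le cov"
  unfolding covering_def forces_simps imp_conjL
proof (intro allI impI conjI, goal_cases)
  case (1 a U q)
  then show ?case by (rule assms(1))
next
  case (2 a U q)
  then show ?case by (rule assms(2))
next
  case (3 a U q)
  then show ?case by (rule assms(3))
next
  case (4 a U V q)
  from 4(1-3) 4(4)[rule_format] show ?case by (rule assms(4))
next
  case (5 a U V q)
  then show ?case by (rule assms(5))
next
  case (6 a b q)
  then show ?case by (rule assms(6))
qed

lemma covering_mono:
  assumes "p \<tturnstile> covering S eq le cov" "q \<le> p" "q \<tturnstile> cov a U" "q \<tturnstile> is_subset S eq V"
    and "\<And>r u. r \<le> q \<Longrightarrow> r \<tturnstile> U u \<Longrightarrow> r \<tturnstile> V u"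
  shows "q \<tturnstile> cov a V"
proof (rule covering_Tra[OF assms(1), OF assms(2,4,3)])
  fix r u assume r: "r \<le> q" "r \<tturnstile> U u"
  then show "r \<tturnstile> cov u V"
    using assms(2,4) assms(5)[OF r] by (intro covering_Ref[OF assms(1)]) auto
qed

lemma covering_down:
  assumes "p \<tturnstile> covering S eq le cov" "q \<le> p" "q \<tturnstile> S a" "q \<tturnstile> le a b"
    and U: "q \<tturnstile> is_subset S eq U" "q \<tturnstile> U b" and set: "p \<tturnstile> is_set S eq"
  shows "q \<tturnstile> cov a U"
proof -
  have b: "q \<tturnstile> S b" using U unfolding forces_is_subset by blast
  show ?thesis
  proof (rule covering_mono[OF assms(1), OF assms(2) covering_Ext[OF assms(1), OF assms(2,3) b assms(4)] U(1)])
    fix r x assume r: "r \<le> q" "r \<tturnstile> (S x \<^bold>\<and> eq x b)"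
    then have "r \<tturnstile> S x" "r \<tturnstile> eq x b" "r \<tturnstile> S b" "r \<tturnstile> U b" "r \<le> p"
      using b U(2) \<open>q \<le> p\<close> by (auto simp: forces_and)
    moreover from this have "r \<tturnstile> eq b x"
      by (intro is_set_sym[OF set, of r x b])
    ultimately show "r \<tturnstile> U x" using U(1) r(1) unfolding forces_is_subset by blast
  qed
qed

lemma is_subset_singleton:
  assumes "p \<tturnstile> is_set S eq" "q \<le> p" "q \<tturnstile> S b"
  shows "q \<tturnstile> is_subset S eq (\<lambda>x. S x \<^bold>\<and> eq x b)"
  unfolding forces_is_subset forces_and
proof (intro conjI allI impI; (elim conjE)?)
  fix x y r assume r: "r \<le> q" "r \<tturnstile> S x" "r \<tturnstile> S y" "r \<tturnstile> eq x y" "r \<tturnstile> eq x b"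
  then have "r \<le> p" "r \<tturnstile> S b" using assms by auto
  moreover from this r have "r \<tturnstile> eq y x" by (intro is_set_sym[OF assms(1), of r x y])
  ultimately show "r \<tturnstile> eq y b" using r by (intro is_set_trans[OF assms(1), of r y x b])
qed

text \<open>
  The set in (Loc) respects equality as soon as the order does so in its lower argument. For
  subsets \<open>U\<close> and \<open>V\<close> that cover a common element one could read this off from (Loc) itself, but for
  the closed sublocale only \<open>U \<union> N\<close> and \<open>V \<union> N\<close> are known to cover anything.
\<close>

lemma is_subset_meet:
  assumes le_cong: "\<And>q x y u. q \<le> p \<Longrightarrow> q \<tturnstile> S x \<Longrightarrow> q \<tturnstile> S y \<Longrightarrow> q \<tturnstile> S u \<Longrightarrow>
      q \<tturnstile> eq x y \<Longrightarrow> q \<tturnstile> le x u \<Longrightarrow> q \<tturnstile> le y u"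
    and "q \<le> p" "q \<tturnstile> is_subset S eq U" "q \<tturnstile> is_subset S eq V"
  shows "q \<tturnstile> is_subset S eq (\<lambda>x. S x \<^bold>\<and> (\<^bold>\<exists>u v. U u \<^bold>\<and> V v \<^bold>\<and> le x u \<^bold>\<and> le x v))"
  unfolding forces_is_subset
proof (intro conjI allI impI; (elim conjE)?)
  fix x r assume "r \<tturnstile> (S x \<^bold>\<and> (\<^bold>\<exists>u v. U u \<^bold>\<and> V v \<^bold>\<and> le x u \<^bold>\<and> le x v))"
  then show "r \<tturnstile> S x" by (simp add: forces_and)
next
  fix x y r
  assume r: "r \<le> q" "r \<tturnstile> S y" "r \<tturnstile> eq x y"
    and "r \<tturnstile> (S x \<^bold>\<and> (\<^bold>\<exists>u v. U u \<^bold>\<and> V v \<^bold>\<and> le x u \<^bold>\<and> le x v))"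
  then have x: "r \<tturnstile> S x" and "r \<tturnstile> (\<^bold>\<exists>u v. U u \<^bold>\<and> V v \<^bold>\<and> le x u \<^bold>\<and> le x v)"
    by (simp_all add: forces_and)
  from this(2) have "r \<tturnstile> (\<^bold>\<exists>u v. U u \<^bold>\<and> V v \<^bold>\<and> le y u \<^bold>\<and> le y v)"
  proof (elim forces_exE)
    fix s t u v assume s: "s \<le> r" "t \<le> s" and uv: "t \<tturnstile> (U u \<^bold>\<and> V v \<^bold>\<and> le x u \<^bold>\<and> le x v)"
    then have t: "t \<le> q" "t \<tturnstile> S x" "t \<tturnstile> S y" "t \<tturnstile> eq x y" "t \<le> p"
      using r x \<open>q \<le> p\<close> by auto
    moreover have "t \<tturnstile> S u" "t \<tturnstile> S v"
      using assms(3,4) uv \<open>t \<le> q\<close> unfolding forces_is_subset forces_and by blast+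
    ultimately have "t \<tturnstile> (U u \<^bold>\<and> V v \<^bold>\<and> le y u \<^bold>\<and> le y v)"
      using uv le_cong unfolding forces_and by blast
    then show "t \<tturnstile> (\<^bold>\<exists>u v. U u \<^bold>\<and> V v \<^bold>\<and> le y u \<^bold>\<and> le y v)"
      by (intro forces_exI)
  qed
  with r(2) show "r \<tturnstile> (S y \<^bold>\<and> (\<^bold>\<exists>u v. U u \<^bold>\<and> V v \<^bold>\<and> le y u \<^bold>\<and> le y v))"
    by (simp add: forces_and)
qed

lemma contains_coverD:
  "p \<tturnstile> contains_cover cov' cov \<Longrightarrow> q \<le> p \<Longrightarrow> q \<tturnstile> cov a U \<Longrightarrow> q \<tturnstile> cov' a U"
  unfolding contains_cover_def forces_simps by blast

lemma closed_cover_contains: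
  assumes cov: "p \<tturnstile> covering S eq le cov" and N: "p \<tturnstile> is_subset S eq N"
  shows "p \<tturnstile> contains_cover (closed_cover S eq cov N) cov"
  unfolding contains_cover_def closed_cover_def forces_simps
proof (intro allI impI conjI)
  fix a U q assume q: "q \<le> p" "q \<tturnstile> cov a U"
  then show U: "q \<tturnstile> is_subset S eq U" by (rule covering_subset[OF cov])
  show "q \<tturnstile> cov a (\<lambda>v. U v \<^bold>\<or> N v)"
    using q is_subset_or[OF U order_trans[OF q(1) N]]
    by (rule covering_mono[OF cov, OF _ _ _ forces_orI1])
qed

text \<open>
  Only (Loc) needs an idea: by (Loc) for the given covering, \<open>a\<close> is covered by the elements below both
  some member of \<open>U \<union> N\<close> and some member of \<open>V \<union> N\<close>. Such an element lies below members
  of \<open>U\<close> and of \<open>V\<close>, or it lies below a member of \<open>N\<close>, and then (Ext) lets \<open>N\<close> absorb it.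
\<close>

lemma closed_cover_covering:
  assumes set: "p \<tturnstile> is_set S eq"
    and le_cong: "\<And>q x y u. q \<le> p \<Longrightarrow> q \<tturnstile> S x \<Longrightarrow> q \<tturnstile> S y \<Longrightarrow> q \<tturnstile> S u \<Longrightarrow>
      q \<tturnstile> eq x y \<Longrightarrow> q \<tturnstile> le x u \<Longrightarrow> q \<tturnstile> le y u"
    and cov: "p \<tturnstile> covering S eq le cov" and N: "p \<tturnstile> is_subset S eq N"
  shows "p \<tturnstile> covering S eq le (closed_cover S eq cov N)"
proof -
  have N': "q \<tturnstile> is_subset S eq N" if "q \<le> p" for q using that N by (rule order_trans)
  have contains: "q \<tturnstile> closed_cover S eq cov N a U" if "q \<le> p" "q \<tturnstile> cov a U" for q a U
    using that by (rule contains_coverD[OF closed_cover_contains[OF cov N]])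
  show ?thesis
  proof (rule coveringI)
    fix q a U assume q: "q \<le> p" "q \<tturnstile> closed_cover S eq cov N a U"
    then show "q \<tturnstile> S a" "q \<tturnstile> is_subset S eq U"
      unfolding closed_cover_def forces_and using covering_elem[OF cov] by blast+
  next
    fix q a U assume "q \<le> p" "q \<tturnstile> is_subset S eq U" "q \<tturnstile> U a"
    then show "q \<tturnstile> closed_cover S eq cov N a U"
      by (intro contains covering_Ref[OF cov])
  next
    fix q a U V
    assume q: "q \<le> p" and V: "q \<tturnstile> is_subset S eq V" and aU: "q \<tturnstile> closed_cover S eq cov N a U"
      and UV: "\<And>u r. r \<le> q \<Longrightarrow> r \<tturnstile> U u \<Longrightarrow> r \<tturnstile> closed_cover S eq cov N u V"
    have VN: "q \<tturnstile> is_subset S eq (\<lambda>v. V v \<^bold>\<or> N v)" by (rule is_subset_or[OF V N'[OF q]])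
    from aU have "q \<tturnstile> cov a (\<lambda>v. U v \<^bold>\<or> N v)" by (simp add: closed_cover_def forces_and)
    then have "q \<tturnstile> cov a (\<lambda>v. V v \<^bold>\<or> N v)"
    proof (rule covering_Tra[OF cov, OF q VN])
      fix r u assume r: "r \<le> q" and "r \<tturnstile> (U u \<^bold>\<or> N u)"
      from this(2) show "r \<tturnstile> cov u (\<lambda>v. V v \<^bold>\<or> N v)"
      proof (rule forces_orE)
        fix s assume "s \<le> r" "s \<tturnstile> U u"
        then show "s \<tturnstile> cov u (\<lambda>v. V v \<^bold>\<or> N v)"
          using UV[of s u] r by (simp add: closed_cover_def forces_and)
      next
        fix s assume "s \<le> r" "s \<tturnstile> N u"
        then show "s \<tturnstile> cov u (\<lambda>v. V v \<^bold>\<or> N v)"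
          using q r VN by (intro covering_Ref[OF cov] forces_orI2) auto
      qed
    qed
    with V show "q \<tturnstile> closed_cover S eq cov N a V" by (simp add: closed_cover_def forces_and)
  next
    fix q a U V
    assume q: "q \<le> p" and "q \<tturnstile> closed_cover S eq cov N a U" "q \<tturnstile> closed_cover S eq cov N a V"
    then have U: "q \<tturnstile> is_subset S eq U" and V: "q \<tturnstile> is_subset S eq V"
      and aU: "q \<tturnstile> cov a (\<lambda>v. U v \<^bold>\<or> N v)" and aV: "q \<tturnstile> cov a (\<lambda>v. V v \<^bold>\<or> N v)"
      by (simp_all add: closed_cover_def forces_and)
    let ?W = "\<lambda>x. S x \<^bold>\<and> (\<^bold>\<exists>u v. U u \<^bold>\<and> V v \<^bold>\<and> le x u \<^bold>\<and> le x v)"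
    have W: "q \<tturnstile> is_subset S eq ?W"
      by (rule is_subset_meet[OF _ order_refl U V]) (meson le_cong q order_trans)
    have WN: "q \<tturnstile> is_subset S eq (\<lambda>v. ?W v \<^bold>\<or> N v)" by (rule is_subset_or[OF W N'[OF q]])
    have "q \<tturnstile> cov a (\<lambda>v. ?W v \<^bold>\<or> N v)"
    proof (rule covering_Tra[OF cov, OF q WN covering_Loc[OF cov, OF q aU aV]])
      fix r x
      assume r: "r \<le> q"
        and "r \<tturnstile> (S x \<^bold>\<and> (\<^bold>\<exists>u v. (U u \<^bold>\<or> N u) \<^bold>\<and> (V v \<^bold>\<or> N v) \<^bold>\<and> le x u \<^bold>\<and> le x v))"
      then have x: "r \<tturnstile> S x"
        and "r \<tturnstile> (\<^bold>\<exists>u v. (U u \<^bold>\<or> N u) \<^bold>\<and> (V v \<^bold>\<or> N v) \<^bold>\<and> le x u \<^bold>\<and> le x v)"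
        by (simp_all add: forces_and)
      from this(2) show "r \<tturnstile> cov x (\<lambda>v. ?W v \<^bold>\<or> N v)"
      proof (elim forces_exE)
        fix s t u v
        assume "s \<le> r" "t \<le> s" and "t \<tturnstile> ((U u \<^bold>\<or> N u) \<^bold>\<and> (V v \<^bold>\<or> N v) \<^bold>\<and> le x u \<^bold>\<and> le x v)"
        then have t: "t \<le> r" and uv: "t \<tturnstile> (U u \<^bold>\<or> N u)" "t \<tturnstile> (V v \<^bold>\<or> N v)" "t \<tturnstile> le x u" "t \<tturnstile> le x v"
          by (auto simp: forces_and)
        have below_N: "t' \<tturnstile> cov x (\<lambda>v. ?W v \<^bold>\<or> N v)"
          if "t' \<le> t" "t' \<tturnstile> le x n" "t' \<tturnstile> N n" for t' n
          using that t r q x WN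
          by (intro covering_down[OF cov _ _ _ _ _ set, of _ _ n] forces_orI2) auto
        from uv(1) show "t \<tturnstile> cov x (\<lambda>v. ?W v \<^bold>\<or> N v)"
        proof (rule forces_orE)
          fix t1 assume t1: "t1 \<le> t" "t1 \<tturnstile> U u"
          from order_trans[OF t1(1) uv(2)] show "t1 \<tturnstile> cov x (\<lambda>v. ?W v \<^bold>\<or> N v)"
          proof (rule forces_orE)
            fix t2 assume t2: "t2 \<le> t1" "t2 \<tturnstile> V v"
            have "t2 \<tturnstile> (U u \<^bold>\<and> V v \<^bold>\<and> le x u \<^bold>\<and> le x v)" and "t2 \<tturnstile> S x" and "t2 \<le> q"
              using t2 t1 t r x uv(3,4) by (auto simp: forces_and)
            moreover from this(1)
            have "t2 \<tturnstile> (\<^bold>\<exists>u v. U u \<^bold>\<and> V v \<^bold>\<and> le x u \<^bold>\<and> le x v)"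
              by (intro forces_exI)
            ultimately have "t2 \<tturnstile> (?W x \<^bold>\<or> N x)" by (intro forces_orI1) (simp add: forces_and)
            then show "t2 \<tturnstile> cov x (\<lambda>v. ?W v \<^bold>\<or> N v)"
              using q WN \<open>t2 \<le> q\<close> by (intro covering_Ref[OF cov]) auto
          next
            fix t2 assume "t2 \<le> t1" "t2 \<tturnstile> N v"
            then show "t2 \<tturnstile> cov x (\<lambda>v. ?W v \<^bold>\<or> N v)"
              using t1 uv(4) by (intro below_N[of _ v]) auto
          qed
        next
          fix t1 assume "t1 \<le> t" "t1 \<tturnstile> N u"
          then show "t1 \<tturnstile> cov x (\<lambda>v. ?W v \<^bold>\<or> N v)"
            using uv(3) by (intro below_N[of _ u]) auto
        qed
      qed
    qed
    with W show "q \<tturnstile> closed_cover S eq cov N a ?W" by (simp add: closed_cover_def forces_and)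
  next
    fix q a b assume "q \<le> p" "q \<tturnstile> S a" "q \<tturnstile> S b" "q \<tturnstile> le a b"
    then show "q \<tturnstile> closed_cover S eq cov N a (\<lambda>x. S x \<^bold>\<and> eq x b)"
      by (intro contains covering_Ext[OF cov])
  qed
qed

lemma is_subset_complement:
  assumes set: "p \<tturnstile> is_set S eq" and F: "p \<tturnstile> is_subset S eq F"
  shows "p \<tturnstile> is_subset S eq (\<lambda>u. S u \<^bold>\<and> \<^bold>\<not> F u)"
  unfolding forces_is_subset forces_and forces_not
proof (intro conjI allI impI; (elim conjE)?; assumption?)
  fix a b q r
  assume "q \<le> p" "q \<tturnstile> S a" "\<forall>q'\<le>q. q' \<tturnstile> F a \<longrightarrow> q' \<tturnstile> bot" "q \<tturnstile> S b" "q \<tturnstile> eq a b"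
    and r: "r \<le> q" "r \<tturnstile> F b"
  then have "r \<le> p" "r \<tturnstile> S a" "r \<tturnstile> S b" "r \<tturnstile> eq a b" "r \<tturnstile> F a \<longrightarrow> r \<tturnstile> bot"
    by (blast intro: order_trans)+
  moreover from this have "r \<tturnstile> eq b a" by (intro is_set_sym[OF set, of r a b])
  ultimately show "r \<tturnstile> bot" using F r(2) unfolding forces_is_subset by blast
qed

text \<open>
  At a stage where \<open>\<not> F n\<close> holds, \<open>{n' : n' = n and F n}\<close> is empty, so (Tra) turns a cover of
  \<open>n\<close> by it into a cover of \<open>n\<close> by any subset whatsoever.
\<close>

lemma closed_cover_imp_positively_closed_cover:
  assumes "p \<tturnstile> closed_cover S eq cov (\<lambda>u. S u \<^bold>\<and> \<^bold>\<not> F u) a V"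
  shows "p \<tturnstile> positively_closed_cover S eq le cov F a V"
  unfolding positively_closed_cover_def is_sublocale_def forces_all forces_imp forces_and
proof (intro allI impI, elim conjE)
  fix C q
  assume q: "q \<le> p" and C: "q \<tturnstile> covering S eq le C" and sub: "q \<tturnstile> contains_cover C cov"
    and F: "\<forall>u. \<forall>r\<le>q. r \<tturnstile> S u \<longrightarrow> r \<tturnstile> C u (\<lambda>u'. S u' \<^bold>\<and> eq u' u \<^bold>\<and> F u)"
  let ?VN = "\<lambda>v. V v \<^bold>\<or> S v \<^bold>\<and> \<^bold>\<not> F v"
  have V: "q \<tturnstile> is_subset S eq V" and "q \<tturnstile> cov a ?VN"
    using order_trans[OF q assms] by (simp_all add: closed_cover_def forces_and)
  from V contains_coverD[OF sub, OF order_refl this(2)] show "q \<tturnstile> C a V"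
  proof (rule covering_Tra[OF C, OF order_refl])
    fix r u assume r: "r \<le> q" "r \<tturnstile> ?VN u"
    from r(2) show "r \<tturnstile> C u V"
    proof (rule forces_orE)
      fix s assume "s \<le> r" "s \<tturnstile> V u"
      then show "s \<tturnstile> C u V" using r V by (intro covering_Ref[OF C]) auto
    next
      fix s assume s: "s \<le> r" "s \<tturnstile> (S u \<^bold>\<and> \<^bold>\<not> F u)"
      then have "s \<le> q" and notF: "s \<tturnstile> (\<^bold>\<not> F u)"
        and u: "s \<tturnstile> C u (\<lambda>u'. S u' \<^bold>\<and> eq u' u \<^bold>\<and> F u)"
        using r(1) F[rule_format, of s u] by (simp_all add: forces_and)
      from \<open>s \<le> q\<close> order_trans[OF \<open>s \<le> q\<close> V] u show "s \<tturnstile> C u V"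
      proof (rule covering_Tra[OF C])
        fix t u' assume "t \<le> s" "t \<tturnstile> (S u' \<^bold>\<and> eq u' u \<^bold>\<and> F u)"
        then have "t \<le> s" "t \<tturnstile> F u" by (simp_all add: forces_and)
        with notF show "t \<tturnstile> C u' V" by (rule forces_notE)
      qed
    qed
  qed
qed

section \<open>The localic completion as a covering\<close>

lemma
  assumes "p \<tturnstile> metric_space X eq d"
  shows metric_is_set: "p \<tturnstile> is_set X eq"
    and metric_open: "q \<le> p \<Longrightarrow> q \<tturnstile> X x \<Longrightarrow> q \<tturnstile> X y \<Longrightarrow> q \<tturnstile> d x y r \<Longrightarrow>
      q \<tturnstile> (\<^bold>\<exists>s. \<^bold>[s < r\<^bold>] \<^bold>\<and> d x y s)"
    and metric_eq_imp_small: "q \<le> p \<Longrightarrow> q \<tturnstile> X x \<Longrightarrow> q \<tturnstile> X y \<Longrightarrow> q \<tturnstile> eq x y \<Longrightarrow>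
      0 < r \<Longrightarrow> q \<tturnstile> d x y r"
    and metric_sym: "q \<le> p \<Longrightarrow> q \<tturnstile> X x \<Longrightarrow> q \<tturnstile> X y \<Longrightarrow> q \<tturnstile> d x y r \<Longrightarrow> q \<tturnstile> d y x r"
    and metric_triangle: "q \<le> p \<Longrightarrow> q \<tturnstile> X x \<Longrightarrow> q \<tturnstile> X y \<Longrightarrow> q \<tturnstile> X z \<Longrightarrow>
      q \<tturnstile> d x y r \<Longrightarrow> q \<tturnstile> d y z s \<Longrightarrow> q \<tturnstile> d x z (r + s)"
proof -
  note M = assms[unfolded metric_space_def forces_simps imp_conjL]
  note from_open = M[THEN conjunct2, THEN conjunct2, THEN conjunct2]
  note from_sym = from_open[THEN conjunct2, THEN conjunct2]
  show "p \<tturnstile> is_set X eq" by (rule M[THEN conjunct1])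
  show "q \<le> p \<Longrightarrow> q \<tturnstile> X x \<Longrightarrow> q \<tturnstile> X y \<Longrightarrow> q \<tturnstile> d x y r \<Longrightarrow> q \<tturnstile> (\<^bold>\<exists>s. \<^bold>[s < r\<^bold>] \<^bold>\<and> d x y s)"
    by (rule from_open[THEN conjunct1, rule_format])
  show "q \<tturnstile> d x y r" if "q \<le> p" "q \<tturnstile> X x" "q \<tturnstile> X y" "q \<tturnstile> eq x y" "0 < r"
    using from_open[THEN conjunct2, THEN conjunct1, rule_format, OF that(1-3), THEN conjunct2,
      rule_format, OF order_refl that(4) order_refl forces_decidableI, OF that(5)] .
  show "q \<le> p \<Longrightarrow> q \<tturnstile> X x \<Longrightarrow> q \<tturnstile> X y \<Longrightarrow> q \<tturnstile> d x y r \<Longrightarrow> q \<tturnstile> d y x r"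
    by (rule from_sym[THEN conjunct1, rule_format, THEN conjunct1, rule_format, OF _ _ _ order_refl])
  show "q \<le> p \<Longrightarrow> q \<tturnstile> X x \<Longrightarrow> q \<tturnstile> X y \<Longrightarrow> q \<tturnstile> X z \<Longrightarrow>
      q \<tturnstile> d x y r \<Longrightarrow> q \<tturnstile> d y z s \<Longrightarrow> q \<tturnstile> d x z (r + s)"
    by (rule from_sym[THEN conjunct2, rule_format])
qed

text \<open>
  Improving \<open>d(x,y) < r\<close> to \<open>d(x,y) < s\<close> with \<open>s < r\<close> leaves room for the detour from \<open>x'\<close>
  to \<open>x\<close>, which has length less than \<open>r - s\<close> since \<open>x = x'\<close>.
\<close>

lemma metric_cong:
  assumes M: "p \<tturnstile> metric_space X eq d"
    and q: "q \<le> p" "q \<tturnstile> X x" "q \<tturnstile> X x'" "q \<tturnstile> X y" "q \<tturnstile> eq x x'" "q \<tturnstile> d x y r"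
  shows "q \<tturnstile> d x' y r"
  using metric_open[OF M, OF q(1,2,4,6)]
proof (rule forces_exE)
  fix q' s assume q': "q' \<le> q" and s: "q' \<tturnstile> (\<^bold>[s < r\<^bold>] \<^bold>\<and> d x y s)"
  then have "q' \<tturnstile> \<^bold>[s < r\<^bold>]" by (simp add: forces_and)
  then show "q' \<tturnstile> d x' y r"
  proof (rule forces_decidableE)
    assume "s < r"
    have st: "q' \<le> p" "q' \<tturnstile> X x" "q' \<tturnstile> X x'" "q' \<tturnstile> X y" "q' \<tturnstile> eq x x'" "q' \<tturnstile> d x y s"
      using q q' s by (auto simp: forces_and)
    from \<open>s < r\<close> have "0 < r - s" by simp
    from metric_eq_imp_small[OF M, OF st(1-3,5) this]
    have "q' \<tturnstile> d x' x (r - s)" by (rule metric_sym[OF M, OF st(1-3)])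
    from metric_triangle[OF M, OF st(1,3,2,4) this st(6)] show ?thesis by simp
  qed
qed

lemma ball_is_set:
  assumes "p \<tturnstile> is_set X eq"
  shows "p \<tturnstile> is_set (ball X) (ball_eq eq)"
  unfolding is_set_def split_paired_All ball.simps ball_eq.simps forces_simps imp_conjL
proof (intro allI impI conjI, goal_cases)
  case (1 x r q)
  then show ?case by (intro is_set_refl[OF assms])
next
  case (2 x r q)
  then show ?case by (intro forces_decidableI refl)
next
  case (3 x r y s q)
  then show ?case by (intro is_set_sym[OF assms, of q x y])
next
  case (4 x r y s q)
  from 4(7) show ?case by (rule forces_decidableE) (simp add: forces_decidableI)
next
  case (5 x r y s z t q)
  then show ?case by (intro is_set_trans[OF assms, of q x y z])
next
  case (6 x r y s z t q)
  from 6(9) show ?case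
  proof (rule forces_decidableE)
    assume "r = s"
    with 6(11) show ?thesis by simp
  qed
qed

lemma ball_le_cong:
  assumes M: "p \<tturnstile> metric_space X eq d" and "q \<le> p"
    and "q \<tturnstile> ball X v" "q \<tturnstile> ball X w" "q \<tturnstile> ball X u" "q \<tturnstile> ball_eq eq v w" "q \<tturnstile> ball_le d v u"
  shows "q \<tturnstile> ball_le d w u"
proof -
  obtain x r y r' z s where balls: "v = (x, r)" "w = (y, r')" "u = (z, s)"
    by (metis surj_pair)
  have q: "q \<tturnstile> X x" "q \<tturnstile> X y" "q \<tturnstile> X z" "q \<tturnstile> eq x y" and "q \<tturnstile> \<^bold>[r = r'\<^bold>]"
    using assms(3-6) by (simp_all add: balls forces_and)
  from this(5) show ?thesis
  proof (rule forces_decidableE)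
    assume "r = r'"
    note le = assms(7)[unfolded balls ball_le.simps forces_all forces_imp \<open>r = r'\<close>, rule_format]
    show ?thesis
      unfolding balls ball_le.simps forces_all forces_imp
    proof (intro allI impI)
      fix t q' assume q': "q' \<le> q" and "q' \<tturnstile> \<^bold>[s - r' < t\<^bold>]"
      then have "q' \<tturnstile> d x z t" by (rule le)
      then show "q' \<tturnstile> d y z t"
        using q' q \<open>q \<le> p\<close> by (intro metric_cong[OF M, of q' x y z t]) auto
    qed
  qed
qed

lemma ball_less_cong:
  assumes M: "p \<tturnstile> metric_space X eq d" and "q \<le> p"
    and "q \<tturnstile> ball X v" "q \<tturnstile> ball X w" "q \<tturnstile> ball X u" "q \<tturnstile> ball_eq eq v w" "q \<tturnstile> ball_less d v u"
  shows "q \<tturnstile> ball_less d w u"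
proof -
  obtain x r y r' z s where balls: "v = (x, r)" "w = (y, r')" "u = (z, s)"
    by (metis surj_pair)
  have q: "q \<tturnstile> X x" "q \<tturnstile> X y" "q \<tturnstile> X z" "q \<tturnstile> eq x y" "q \<tturnstile> d x z (s - r)"
    and "q \<tturnstile> \<^bold>[r = r'\<^bold>]"
    using assms(3-7) by (simp_all add: balls forces_and)
  from this(6) show ?thesis
  proof (rule forces_decidableE)
    assume "r = r'"
    with q \<open>q \<le> p\<close> show ?thesis
      unfolding balls ball_less.simps by (intro metric_cong[OF M, of q x y z]) auto
  qed
qed

lemma ball_less_imp_le:
  assumes M: "p \<tturnstile> metric_space X eq d" and q: "q \<le> p"
    and v: "q \<tturnstile> ball X v" and u: "q \<tturnstile> ball X u" and less: "q \<tturnstile> ball_less d v u"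
  shows "q \<tturnstile> ball_le d v u"
proof -
  obtain x r y s where [simp]: "v = (x, r)" "u = (y, s)" by (metis surj_pair)
  show ?thesis
    unfolding \<open>v = _\<close> \<open>u = _\<close> ball_le.simps forces_all forces_imp
  proof (intro allI impI)
    fix t q' assume q': "q' \<le> q" and "q' \<tturnstile> \<^bold>[s - r < t\<^bold>]"
    from this(2) show "q' \<tturnstile> d x y t"
    proof (rule forces_decidableE)
      assume t: "s - r < t"
      have st: "q' \<le> p" "q' \<tturnstile> X x" "q' \<tturnstile> X y" "q' \<tturnstile> d x y (s - r)"
        using q q' v u less by (auto simp: forces_and)
      then have "q' \<tturnstile> eq y y" by (intro is_set_refl[OF metric_is_set[OF M]])
      moreover have "0 < t - (s - r)" using t by simp
      ultimately have "q' \<tturnstile> d y y (t - (s - r))"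
        by (rule metric_eq_imp_small[OF M, OF st(1,3,3)])
      from metric_triangle[OF M, OF st(1,2,3,3,4) this] show ?thesis by simp
    qed
  qed
qed

text \<open>
  The sets in (M1) and (M2) have to be subsets, that is, respect equality, for the covering of every
  element by every subset to satisfy these axioms.
\<close>

lemma is_subset_smaller_balls:
  assumes M: "p \<tturnstile> metric_space X eq d" and q: "q \<le> p" "q \<tturnstile> ball X u"
  shows "q \<tturnstile> is_subset (ball X) (ball_eq eq) (\<lambda>v. ball X v \<^bold>\<and> ball_less d v u)"
  unfolding forces_is_subset forces_and
proof (intro conjI allI impI; (elim conjE)?)
  fix v w r
  assume "r \<le> q" "r \<tturnstile> ball X w" "r \<tturnstile> ball_eq eq v w" "r \<tturnstile> ball X v" "r \<tturnstile> ball_less d v u"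
  then show "r \<tturnstile> ball_less d w u"
    using q by (intro ball_less_cong[OF M, of r v w u]) auto
qed

lemma is_subset_balls_of_radius:
  "p \<tturnstile> is_subset (ball X) (ball_eq eq) (\<lambda>v. ball X v \<^bold>\<and> \<^bold>[snd v = r\<^bold>])"
  unfolding forces_is_subset forces_and
proof (intro conjI allI impI; (elim conjE)?; assumption?)
  fix v w q assume "q \<tturnstile> ball_eq eq v w" "q \<tturnstile> \<^bold>[snd v = r\<^bold>]"
  then have "q \<tturnstile> \<^bold>[snd v = snd w\<^bold>]" by (cases v; cases w) (simp add: forces_and)
  then show "q \<tturnstile> \<^bold>[snd w = r\<^bold>]"
    by (rule forces_decidableE) (use \<open>q \<tturnstile> \<^bold>[snd v = r\<^bold>]\<close> in simp)
qed

text \<open>The coverings over which the intersection in \<open>loc_cover\<close> is taken.\<close>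

definition ball_covering ::
  "('a \<Rightarrow> 'h::frame) \<Rightarrow> ('a \<Rightarrow> 'a \<Rightarrow> 'h) \<Rightarrow> ('a \<Rightarrow> 'a \<Rightarrow> rat \<Rightarrow> 'h) \<Rightarrow>
    ('a \<times> rat \<Rightarrow> ('a \<times> rat \<Rightarrow> 'h) \<Rightarrow> 'h) \<Rightarrow> 'h" where
  "ball_covering X eq d C =
    (covering (ball X) (ball_eq eq) (ball_le d) C \<^bold>\<and>
     (\<^bold>\<forall>u. ball X u \<^bold>\<longrightarrow> C u (\<lambda>v. ball X v \<^bold>\<and> ball_less d v u)) \<^bold>\<and>
     (\<^bold>\<forall>r. \<^bold>[0 < r\<^bold>] \<^bold>\<longrightarrow> (\<^bold>\<forall>u. ball X u \<^bold>\<longrightarrow> C u (\<lambda>v. ball X v \<^bold>\<and> \<^bold>[snd v = r\<^bold>]))))"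

lemma loc_cover_eq: "loc_cover X eq d a U = (\<^bold>\<forall>C. ball_covering X eq d C \<^bold>\<longrightarrow> C a U)"
  unfolding loc_cover_def ball_covering_def ..

lemma loc_coverI:
  "(\<And>C q. q \<le> p \<Longrightarrow> q \<tturnstile> ball_covering X eq d C \<Longrightarrow> q \<tturnstile> C a U) \<Longrightarrow> p \<tturnstile> loc_cover X eq d a U"
  unfolding loc_cover_eq forces_all forces_imp by (intro allI impI)

lemma loc_coverD:
  assumes "p \<tturnstile> loc_cover X eq d a U" "q \<le> p" "q \<tturnstile> ball_covering X eq d C"
  shows "q \<tturnstile> C a U"
  by (rule assms(1)[unfolded loc_cover_eq forces_all forces_imp, rule_format, OF assms(2,3)])

lemma ball_covering_covering:
  "p \<tturnstile> ball_covering X eq d C \<Longrightarrow> p \<tturnstile> covering (ball X) (ball_eq eq) (ball_le d) C"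
  unfolding ball_covering_def forces_and by (erule conjunct1)

lemma loc_cover_M1:
  assumes "p \<tturnstile> ball X u"
  shows "p \<tturnstile> loc_cover X eq d u (\<lambda>v. ball X v \<^bold>\<and> ball_less d v u)"
proof (rule loc_coverI)
  fix C q assume q: "q \<le> p" and C: "q \<tturnstile> ball_covering X eq d C"
  show "q \<tturnstile> C u (\<lambda>v. ball X v \<^bold>\<and> ball_less d v u)"
    by (rule C[unfolded ball_covering_def forces_simps, THEN conjunct2, THEN conjunct1, rule_format,
      OF order_refl order_trans[OF q assms]])
qed

lemma trivial_covering:
  assumes set: "p \<tturnstile> is_set S eq"
    and le_cong: "\<And>q x y u. q \<le> p \<Longrightarrow> q \<tturnstile> S x \<Longrightarrow> q \<tturnstile> S y \<Longrightarrow> q \<tturnstile> S u \<Longrightarrow>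
      q \<tturnstile> eq x y \<Longrightarrow> q \<tturnstile> le x u \<Longrightarrow> q \<tturnstile> le y u"
  shows "p \<tturnstile> covering S eq le (\<lambda>a U. S a \<^bold>\<and> is_subset S eq U)"
proof (rule coveringI, unfold forces_and, goal_cases)
  case (1 q a U)
  then show ?case by blast
next
  case (2 q a U)
  then show ?case by blast
next
  case (3 q a U)
  then show ?case unfolding forces_is_subset by blast
next
  case (4 q a U V)
  then show ?case by blast
next
  case (5 q a U V)
  then have "q \<tturnstile> S a" and U: "q \<tturnstile> is_subset S eq U" and V: "q \<tturnstile> is_subset S eq V" by blast+
  have "q \<tturnstile> is_subset S eq (\<lambda>x. S x \<^bold>\<and> (\<^bold>\<exists>u v. U u \<^bold>\<and> V v \<^bold>\<and> le x u \<^bold>\<and> le x v))"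
    by (rule is_subset_meet[OF _ 5(1) U V]) (rule le_cong)
  with \<open>q \<tturnstile> S a\<close> show ?case by blast
next
  case (6 q a b)
  from is_subset_singleton[OF set, OF 6(1,3)] 6(2) show ?case by blast
qed

lemma loc_cover_covering:
  assumes M: "p \<tturnstile> metric_space X eq d"
  shows "p \<tturnstile> covering (ball X) (ball_eq eq) (ball_le d) (loc_cover X eq d)"
proof -
  let ?S = "ball X" and ?eq = "ball_eq eq" and ?le = "ball_le d"
  let ?triv = "\<lambda>a U. ?S a \<^bold>\<and> is_subset ?S ?eq U"
  have "p \<tturnstile> ball_covering X eq d ?triv"
    unfolding ball_covering_def forces_simps
  proof (intro conjI allI impI)
    show "p \<tturnstile> covering ?S ?eq ?le ?triv"
      by (rule trivial_covering[OF ball_is_set[OF metric_is_set[OF M]]]) (rule ball_le_cong[OF M])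
  next
    fix u q assume "q \<le> p" "q \<tturnstile> ?S u"
    then show "q \<tturnstile> is_subset ?S ?eq (\<lambda>v. ?S v \<^bold>\<and> ball_less d v u)"
      by (rule is_subset_smaller_balls[OF M])
  qed (assumption | rule is_subset_balls_of_radius)+
  then have "q \<tturnstile> ?triv a U" if "q \<le> p" "q \<tturnstile> loc_cover X eq d a U" for q a U
    by (rule loc_coverD[OF that(2) order_refl order_trans[OF that(1)]])
  note trivial = this[unfolded forces_and]
  show ?thesis
  proof (rule coveringI)
    fix q a U assume "q \<le> p" "q \<tturnstile> loc_cover X eq d a U"
    from trivial[OF this] show "q \<tturnstile> ?S a" "q \<tturnstile> is_subset ?S ?eq U" by blast+
  next
    fix q a U assume U: "q \<tturnstile> is_subset ?S ?eq U" "q \<tturnstile> U a"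
    show "q \<tturnstile> loc_cover X eq d a U"
    proof (rule loc_coverI)
      fix C r assume r: "r \<le> q" and C: "r \<tturnstile> ball_covering X eq d C"
      from order_trans[OF r U(1)] order_trans[OF r U(2)] show "r \<tturnstile> C a U"
        by (rule covering_Ref[OF ball_covering_covering[OF C], OF order_refl])
    qed
  next
    fix q a U V
    assume V: "q \<tturnstile> is_subset ?S ?eq V" and aU: "q \<tturnstile> loc_cover X eq d a U"
      and UV: "\<And>u r. r \<le> q \<Longrightarrow> r \<tturnstile> U u \<Longrightarrow> r \<tturnstile> loc_cover X eq d u V"
    show "q \<tturnstile> loc_cover X eq d a V"
    proof (rule loc_coverI)
      fix C r assume r: "r \<le> q" and C: "r \<tturnstile> ball_covering X eq d C"
      from order_trans[OF r V] loc_coverD[OF aU r C] show "r \<tturnstile> C a V"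
      proof (rule covering_Tra[OF ball_covering_covering[OF C], OF order_refl])
        fix s u assume s: "s \<le> r" "s \<tturnstile> U u"
        from UV[OF order_trans[OF s(1) r] s(2)] show "s \<tturnstile> C u V"
          by (rule loc_coverD[OF _ order_refl order_trans[OF s(1) C]])
      qed
    qed
  next
    fix q a U V assume aU: "q \<tturnstile> loc_cover X eq d a U" and aV: "q \<tturnstile> loc_cover X eq d a V"
    show "q \<tturnstile> loc_cover X eq d a
        (\<lambda>x. ?S x \<^bold>\<and> (\<^bold>\<exists>u v. U u \<^bold>\<and> V v \<^bold>\<and> ?le x u \<^bold>\<and> ?le x v))"
    proof (rule loc_coverI)
      fix C r assume r: "r \<le> q" and C: "r \<tturnstile> ball_covering X eq d C"
      from loc_coverD[OF aU r C] loc_coverD[OF aV r C]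
      show "r \<tturnstile> C a (\<lambda>x. ?S x \<^bold>\<and> (\<^bold>\<exists>u v. U u \<^bold>\<and> V v \<^bold>\<and> ?le x u \<^bold>\<and> ?le x v))"
        by (rule covering_Loc[OF ball_covering_covering[OF C], OF order_refl])
    qed
  next
    fix q a b assume ab: "q \<tturnstile> ?S a" "q \<tturnstile> ?S b" "q \<tturnstile> ?le a b"
    show "q \<tturnstile> loc_cover X eq d a (\<lambda>x. ?S x \<^bold>\<and> ?eq x b)"
    proof (rule loc_coverI)
      fix C r assume r: "r \<le> q" and C: "r \<tturnstile> ball_covering X eq d C"
      show "r \<tturnstile> C a (\<lambda>x. ?S x \<^bold>\<and> ?eq x b)"
        using r ab by (intro covering_Ext[OF ball_covering_covering[OF C], OF order_refl]) auto
    qed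
  qed
qed

section \<open>Located predicates\<close>

text \<open>
  Locatedness decides between \<open>\<not> Pos v\<close> and \<open>Pos u\<close> only for \<open>v < u\<close>, so \<open>u\<close> first has to be
  replaced by the smaller balls that cover it.
\<close>

lemma located_closed_cover:
  assumes M: "p \<tturnstile> metric_space X eq d" and L: "p \<tturnstile> located_predicate X eq d Pos"
    and N: "p \<tturnstile> is_subset (ball X) (ball_eq eq) (\<lambda>u. ball X u \<^bold>\<and> \<^bold>\<not> Pos u)"
    and q: "q \<le> p" and u: "q \<tturnstile> ball X u"
  shows "q \<tturnstile> closed_cover (ball X) (ball_eq eq) (loc_cover X eq d)
      (\<lambda>u. ball X u \<^bold>\<and> \<^bold>\<not> Pos u) u (\<lambda>u'. ball X u' \<^bold>\<and> ball_eq eq u' u \<^bold>\<and> Pos u)"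
proof -
  let ?S = "ball X" and ?eq = "ball_eq eq"
  let ?P = "\<lambda>u'. ?S u' \<^bold>\<and> ?eq u' u \<^bold>\<and> Pos u" and ?N = "\<lambda>u. ?S u \<^bold>\<and> \<^bold>\<not> Pos u"
  note cov = loc_cover_covering[OF M] and set = ball_is_set[OF metric_is_set[OF M]]
  have P: "q \<tturnstile> is_subset ?S ?eq ?P"
    using is_subset_singleton[OF set q u] unfolding forces_is_subset forces_and by blast
  have PN: "q \<tturnstile> is_subset ?S ?eq (\<lambda>v. ?P v \<^bold>\<or> ?N v)"
    by (rule is_subset_or[OF P order_trans[OF q N]])
  have "q \<tturnstile> loc_cover X eq d u (\<lambda>v. ?P v \<^bold>\<or> ?N v)"
  proof (rule covering_Tra[OF cov, OF q PN loc_cover_M1[OF u]])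
    fix r v assume r: "r \<le> q" and "r \<tturnstile> (?S v \<^bold>\<and> ball_less d v u)"
    then have st: "r \<le> p" "r \<tturnstile> ?S v" "r \<tturnstile> ball_less d v u" "r \<tturnstile> ?S u"
      using q u by (auto simp: forces_and)
    then have "r \<tturnstile> (\<^bold>\<not> Pos v \<^bold>\<or> Pos u)"
      by (intro L[unfolded located_predicate_def forces_simps imp_conjL, THEN conjunct2, rule_format])
    then show "r \<tturnstile> loc_cover X eq d v (\<lambda>v. ?P v \<^bold>\<or> ?N v)"
    proof (rule forces_orE)
      fix s assume s: "s \<le> r" "s \<tturnstile> (\<^bold>\<not> Pos v)"
      then have "s \<tturnstile> (?P v \<^bold>\<or> ?N v)" using st by (intro forces_orI2) (auto simp: forces_and)
      then show "s \<tturnstile> loc_cover X eq d v (\<lambda>v. ?P v \<^bold>\<or> ?N v)"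
        using s r q PN by (intro covering_Ref[OF cov]) auto
    next
      fix s assume s: "s \<le> r" "s \<tturnstile> Pos u"
      then have st: "s \<le> p" "s \<tturnstile> ?S v" "s \<tturnstile> ball_less d v u" "s \<tturnstile> ?S u"
        using st by auto
      then have "s \<tturnstile> ?eq u u" by (intro is_set_refl[OF set])
      then have "s \<tturnstile> (?P u \<^bold>\<or> ?N u)"
        using st s by (intro forces_orI1) (simp add: forces_and)
      then show "s \<tturnstile> loc_cover X eq d v (\<lambda>v. ?P v \<^bold>\<or> ?N v)"
        using s r PN st
        by (intro covering_down[OF cov _ _ ball_less_imp_le[OF M] _ _ set]) auto
    qed
  qed
  with P show ?thesis by (simp add: closed_cover_def forces_and)
qed

theorem proposition10:
  fixes X :: "'a \<Rightarrow> 'h::frame"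
    and eq :: "'a \<Rightarrow> 'a \<Rightarrow> 'h"
    and d :: "'a \<Rightarrow> 'a \<Rightarrow> rat \<Rightarrow> 'h"
    and Pos :: "'a \<times> rat \<Rightarrow> 'h"
  shows "\<Turnstile> metric_space X eq d \<^bold>\<and> located_predicate X eq d Pos \<^bold>\<longrightarrow>
    coincide
      (positively_closed_cover (ball X) (ball_eq eq) (ball_le d) (loc_cover X eq d) Pos)
      (closed_cover (ball X) (ball_eq eq) (loc_cover X eq d) (\<lambda>u. ball X u \<^bold>\<and> \<^bold>\<not> Pos u))"
  unfolding valid_forces coincide_def forces_simps imp_conjL
proof (intro allI impI conjI)
  let ?closed = "closed_cover (ball X) (ball_eq eq) (loc_cover X eq d) (\<lambda>u. ball X u \<^bold>\<and> \<^bold>\<not> Pos u)"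
  fix p' p q :: 'h and a U
  assume "p \<tturnstile> metric_space X eq d" "p \<tturnstile> located_predicate X eq d Pos" "q \<le> p"
    and pos: "q \<tturnstile> positively_closed_cover (ball X) (ball_eq eq) (ball_le d) (loc_cover X eq d) Pos a U"
  then have M: "q \<tturnstile> metric_space X eq d" and L: "q \<tturnstile> located_predicate X eq d Pos" by auto
  note cov = loc_cover_covering[OF M] and set = ball_is_set[OF metric_is_set[OF M]]
  have N: "q \<tturnstile> is_subset (ball X) (ball_eq eq) (\<lambda>u. ball X u \<^bold>\<and> \<^bold>\<not> Pos u)"
    using L by (intro is_subset_complement[OF set])
      (simp add: located_predicate_def positively_closed_def forces_and)
  show "q \<tturnstile> ?closed a U"
  proof (rule pos[unfolded positively_closed_cover_def is_sublocale_def forces_simps imp_conjL,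
        rule_format, OF order_refl])
    show "q \<tturnstile> covering (ball X) (ball_eq eq) (ball_le d) ?closed"
      by (rule closed_cover_covering[OF set _ cov N]) (rule ball_le_cong[OF M])
    show "q \<tturnstile> contains_cover ?closed (loc_cover X eq d)"
      by (rule closed_cover_contains[OF cov N])
    show "\<And>u r. r \<le> q \<Longrightarrow> r \<tturnstile> ball X u \<Longrightarrow>
        r \<tturnstile> ?closed u (\<lambda>u'. ball X u' \<^bold>\<and> ball_eq eq u' u \<^bold>\<and> Pos u)"
      by (rule located_closed_cover[OF M L N])
  qed
qed (rule closed_cover_imp_positively_closed_cover)

end
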